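(* Let $R$ be a ring. Then the following are equivalent: (1) $R$ is strongly 2-nil-clean. (2) For any $a\in R$, there exist idempotents $e,f\in R$ and a nilpotent $w\in R$ that (pairwise) commute such that $a=e+f+w$. (3) For any $a\in R$, there exist idempotents $e,f,g\in R$ and a nilpotent $w\in R$ that (pairwise) commute such that $a=e+f+g+w$.
   Context: All rings are associative with an identity, not necessarily commutative. A ring $R$ is strongly 2-nil-clean if every element of $R$ is the sum of two idempotents and a nilpotent that (pairwise) commute. *)

theory Defs
  imports "HOL-Algebra.Ring"
begin

definition ring_idempotent :: "('a, 'm) ring_scheme \<Rightarrow> 'a \<Rightarrow> bool" where
  "ring_idempotent R e \<longleftrightarrow> e \<in> carrier R \<and> e \<otimes>\<^bsub>R\<^esub> e = e"

definition ring_nilpotent :: "('a, 'm) ring_scheme \<Rightarrow> 'a \<Rightarrow> bool" where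
  "ring_nilpotent R w \<longleftrightarrow> w \<in> carrier R \<and> (\<exists>n::nat. n \<ge> 1 \<and> w [^]\<^bsub>R\<^esub> n = \<zero>\<^bsub>R\<^esub>)"

definition pairwise_commute :: "('a, 'm) ring_scheme \<Rightarrow> 'a set \<Rightarrow> bool" where
  "pairwise_commute R S \<longleftrightarrow> (\<forall>x\<in>S. \<forall>y\<in>S. x \<otimes>\<^bsub>R\<^esub> y = y \<otimes>\<^bsub>R\<^esub> x)"

definition strongly_2_nil_clean :: "('a, 'm) ring_scheme \<Rightarrow> bool" where
  "strongly_2_nil_clean R \<longleftrightarrow>
     (\<forall>a\<in>carrier R. \<exists>e f w.
        ring_idempotent R e \<and> ring_idempotent R f \<and> ring_nilpotent R w \<and>
        pairwise_commute R {e, f, w} \<and> a = e \<oplus>\<^bsub>R\<^esub> f \<oplus>\<^bsub>R\<^esub> w)"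

end

theory Submission
  imports Defs "HOL-Algebra.Subrings"
begin

text \<open>
  The first equivalence is the definition itself, and a third idempotent may always be taken to
  be \<open>0\<close>; the content is that three idempotents can be reduced to two.

  Pairwise commuting elements lie in a commutative subring, their double commutant
  (\<open>cring_double_commutant\<close>). Idempotence and nilpotence do not depend on the ambient ring, so
  each decomposition can be studied, and changed, inside a commutative ring. There the nilpotent
  elements form an ideal, and idempotents lift modulo it (\<open>lift_idempotent\<close>).

  Decomposing \<open>-1\<close> shows that \<open>6\<close> is nilpotent (\<open>nilpotent_six\<close>): a sum of three idempotents takes,
  heuristically, only the values \<open>0, 1, 2, 3\<close>, and if it equals \<open>-1\<close> modulo nilpotents, then
  the product \<open>1 * 2 * 3 * 4 = 24\<close> of the four differences is nilpotent.

  Given idempotents \<open>e\<close>, \<open>f\<close>, \<open>g\<close>, put \<open>p = efg\<close>, the idempotent where the sum takes the value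
  \<open>3\<close>. Pairing \<open>e + f = u + ef\<close> and \<open>ef + g = v + p\<close> by the union rule
  \<open>x + y = (x + y - xy) + xy\<close> gives
  \<open>e + f + g = (u - p) + (v - p) + 3p\<close>, where \<open>u - p\<close> and \<open>v - p\<close> are idempotents
  annihilating \<open>p\<close>. Since \<open>3 * 3 - 3 = 6\<close> is nilpotent, \<open>3\<close> differs from some idempotent \<open>h\<close> by a
  nilpotent. Hence \<open>3p\<close> may be replaced by the idempotent \<open>ph\<close>, which is orthogonal to \<open>u - p\<close> and
  can be absorbed into it: \<open>(u - p) + ph\<close> and \<open>v - p\<close> are the two idempotents
  (\<open>three_idempotents_to_two\<close>).
\<close>

section \<open>Nilpotent elements of a commutative ring\<close>

lemma (in ring) ring_nilpotentI:
  assumes "x \<in> carrier R" "x [^] (n::nat) = \<zero>"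
  shows "ring_nilpotent R x"
proof -
  have "x [^] Suc n = \<zero>"
    using assms by simp
  then show ?thesis
    unfolding ring_nilpotent_def using assms(1) by (metis Suc_eq_plus1 le_add2)
qed

context cring
begin

lemma nilpotent_mult:
  assumes "ring_nilpotent R x" "y \<in> carrier R"
  shows "ring_nilpotent R (x \<otimes> y)"
proof -
  obtain n :: nat where x: "x \<in> carrier R" "x [^] n = \<zero>"
    using assms(1) unfolding ring_nilpotent_def by blast
  then have "(x \<otimes> y) [^] n = \<zero>"
    using assms(2) by (simp add: nat_pow_distrib)
  then show ?thesis
    using x assms(2) by (intro ring_nilpotentI) auto
qed

lemma nilpotent_of_power:
  assumes "x \<in> carrier R" "ring_nilpotent R (x [^] (k::nat))"
  shows "ring_nilpotent R x"
proof -
  obtain n :: nat where "(x [^] k) [^] n = \<zero>"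
    using assms(2) unfolding ring_nilpotent_def by blast
  then have "x [^] (k * n) = \<zero>"
    using assms(1) by (simp add: nat_pow_pow)
  then show ?thesis
    using assms(1) by (intro ring_nilpotentI)
qed

text \<open>
  This replaces the binomial theorem in showing that sums of nilpotents are nilpotent: if
  \<open>y^n = 0\<close>, then \<open>(x + y)^n\<close> is a multiple of \<open>x\<close>.
\<close>

lemma power_add_cong:
  assumes "x \<in> carrier R" "y \<in> carrier R"
  shows "\<exists>c\<in>carrier R. (x \<oplus> y) [^] (n::nat) = x \<otimes> c \<oplus> y [^] n"
proof (induction n)
  case 0
  then show ?case
    using assms by (intro bexI[of _ \<zero>]) auto
next
  case (Suc n)
  then obtain c where c: "c \<in> carrier R" "(x \<oplus> y) [^] n = x \<otimes> c \<oplus> y [^] n"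
    by blast
  have "y [^] n \<in> carrier R"
    using assms by simp
  then have "(x \<otimes> c \<oplus> y [^] n) \<otimes> (x \<oplus> y) = x \<otimes> (c \<otimes> (x \<oplus> y) \<oplus> y [^] n) \<oplus> y [^] n \<otimes> y"
    using assms c(1) by algebra
  then show ?case
    using assms c by (intro bexI[of _ "c \<otimes> (x \<oplus> y) \<oplus> y [^] n"]) auto
qed

lemma nilpotent_add:
  assumes "ring_nilpotent R x" "ring_nilpotent R y"
  shows "ring_nilpotent R (x \<oplus> y)"
proof -
  obtain n :: nat where y: "y \<in> carrier R" "y [^] n = \<zero>"
    using assms(2) unfolding ring_nilpotent_def by blast
  have x: "x \<in> carrier R"
    using assms(1) unfolding ring_nilpotent_def by blast
  obtain c where c: "c \<in> carrier R" "(x \<oplus> y) [^] n = x \<otimes> c"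
    using power_add_cong[OF x y(1), of n] x y(2) by auto
  then have "ring_nilpotent R ((x \<oplus> y) [^] n)"
    using nilpotent_mult[OF assms(1)] by simp
  then show ?thesis
    using nilpotent_of_power x y(1) by blast
qed

lemma nilpotent_cancel:
  assumes "x \<in> carrier R" "ring_nilpotent R (x \<oplus> y)" "ring_nilpotent R y"
  shows "ring_nilpotent R x"
proof -
  have y: "y \<in> carrier R"
    using assms(3) unfolding ring_nilpotent_def by blast
  have "ring_nilpotent R ((x \<oplus> y) \<oplus> y \<otimes> (\<ominus> \<one>))"
    by (intro nilpotent_add nilpotent_mult assms) auto
  moreover have "(x \<oplus> y) \<oplus> y \<otimes> (\<ominus> \<one>) = x"
    using assms(1) y by algebra
  ultimately show ?thesis
    by simp
qed

section \<open>Idempotents of a commutative ring\<close>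

text \<open>
  Idempotents are handled as one half of a pair \<open>x + y = 1\<close>, with \<open>xy\<close> measuring the failure
  of idempotence; this keeps the lifting computation below symmetric and almost free of
  subtraction.
\<close>

lemma idempotent_of_complement:
  assumes "x \<in> carrier R" "y \<in> carrier R" "x \<oplus> y = \<one>" "x \<otimes> y = \<zero>"
  shows "ring_idempotent R x"
proof -
  have "x \<otimes> (x \<oplus> y) = x \<otimes> x \<oplus> x \<otimes> y"
    using assms(1,2) by algebra
  then show ?thesis
    using assms unfolding ring_idempotent_def by simp
qed

text \<open>
  Newton iteration. Splitting \<open>1 = (x + y)^3\<close> into \<open>x' = x^2 (x + 3y)\<close> and
  \<open>y' = y^2 (y + 3x)\<close> gives again a pair with sum \<open>1\<close>, whose product is a multiple of
  \<open>(xy)^2\<close>, so each step halves the exponent that kills the product. As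
  \<open>x = x (x + y)^2\<close>, the change \<open>x - x' = xy (y - x)\<close> is a multiple of \<open>xy\<close>, hence nilpotent.
\<close>

lemma lift_idempotent_pow2:
  assumes "x \<in> carrier R" "y \<in> carrier R" "x \<oplus> y = \<one>" "(x \<otimes> y) [^] ((2::nat) ^ k) = \<zero>"
  shows "\<exists>h n. ring_idempotent R h \<and> ring_nilpotent R n \<and> x = h \<oplus> n"
  using assms
proof (induction k arbitrary: x y)
  case 0
  then have "ring_idempotent R x"
    using idempotent_of_complement by simp
  moreover have "ring_nilpotent R \<zero>"
    by (rule ring_nilpotentI[of _ 1]) auto
  ultimately show ?case
    using 0(1) by (intro exI[of _ x] exI[of _ \<zero>]) simp
next
  case (Suc k)
  note [simp] = \<open>x \<in> carrier R\<close> \<open>y \<in> carrier R\<close>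
  define x' where "x' = x \<otimes> x \<otimes> (x \<oplus> y \<oplus> y \<oplus> y)"
  define y' where "y' = y \<otimes> y \<otimes> (y \<oplus> x \<oplus> x \<oplus> x)"
  define c where "c = (x \<oplus> y \<oplus> y \<oplus> y) \<otimes> (y \<oplus> x \<oplus> x \<oplus> x)"
  have carr: "x' \<in> carrier R" "y' \<in> carrier R" "c \<in> carrier R"
    by (simp_all add: x'_def y'_def c_def)
  have "x' \<oplus> y' = (x \<oplus> y) \<otimes> (x \<oplus> y) \<otimes> (x \<oplus> y)"
    unfolding x'_def y'_def by (simp add: l_distr r_distr a_ac m_ac)
  then have one: "x' \<oplus> y' = \<one>"
    using Suc.prems(3) by simp
  have "x' \<otimes> y' = (x \<otimes> y) \<otimes> (x \<otimes> y) \<otimes> c"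
    unfolding x'_def y'_def c_def by (simp add: m_ac)
  also have "\<dots> = (x \<otimes> y) [^] (2::nat) \<otimes> c"
    by (simp add: numeral_2_eq_2)
  finally have "(x' \<otimes> y') [^] ((2::nat) ^ k) = (x \<otimes> y) [^] ((2::nat) ^ Suc k) \<otimes> c [^] ((2::nat) ^ k)"
    using carr by (simp add: nat_pow_distrib nat_pow_pow)
  then have "(x' \<otimes> y') [^] ((2::nat) ^ k) = \<zero>"
    using Suc.prems(4) carr by (simp del: power_Suc)
  from Suc.IH[OF carr(1,2) one this] obtain h n
    where hn: "ring_idempotent R h" "ring_nilpotent R n" "x' = h \<oplus> n"
    by blast
  define d where "d = (x \<otimes> y) \<otimes> (y \<ominus> x)"
  have "x = x \<otimes> (x \<oplus> y) \<otimes> (x \<oplus> y)"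
    using Suc.prems(3) by simp
  also have "\<dots> = x' \<oplus> d"
    using Suc.prems(1,2) unfolding x'_def d_def by algebra
  finally have "x = h \<oplus> n \<oplus> d"
    using hn(3) by simp
  moreover have "ring_nilpotent R d"
    unfolding d_def
    by (rule nilpotent_mult, rule ring_nilpotentI[OF _ Suc.prems(4)]) auto
  ultimately show ?case
    using hn nilpotent_add unfolding ring_idempotent_def ring_nilpotent_def
    by (intro exI[of _ h] exI[of _ "n \<oplus> d"]) (auto simp: a_assoc nilpotent_add)
qed

text \<open>
  The power of two in the iteration is no restriction, because a vanishing power may be raised
  to any larger exponent.
\<close>

lemma lift_idempotent:
  assumes "x \<in> carrier R" "y \<in> carrier R" "x \<oplus> y = \<one>" "ring_nilpotent R (x \<otimes> y)"
  shows "\<exists>h n. ring_idempotent R h \<and> ring_nilpotent R n \<and> x = h \<oplus> n"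
proof -
  obtain m :: nat where m: "(x \<otimes> y) [^] m = \<zero>"
    using assms(4) unfolding ring_nilpotent_def by blast
  have "(2::nat) ^ m = m + (2 ^ m - m)"
    using less_exp[of m] by linarith
  then have "(x \<otimes> y) [^] ((2::nat) ^ m) = (x \<otimes> y) [^] m \<otimes> (x \<otimes> y) [^] ((2::nat) ^ m - m)"
    using assms(1,2) by (simp add: nat_pow_mult)
  then have "(x \<otimes> y) [^] ((2::nat) ^ m) = \<zero>"
    using m assms(1,2) by simp
  then show ?thesis
    using lift_idempotent_pow2 assms(1-3) by blast
qed

lemma idempotent_mult:
  assumes "ring_idempotent R e" "ring_idempotent R f"
  shows "ring_idempotent R (e \<otimes> f)"
proof -
  have [simp]: "e \<in> carrier R" "f \<in> carrier R"
    using assms unfolding ring_idempotent_def by auto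
  have "(e \<otimes> f) \<otimes> (e \<otimes> f) = (e \<otimes> e) \<otimes> (f \<otimes> f)"
    by (simp add: m_ac)
  then show ?thesis
    using assms unfolding ring_idempotent_def by simp
qed

lemma idempotent_add_orthogonal:
  assumes "ring_idempotent R e" "ring_idempotent R f" "e \<otimes> f = \<zero>"
  shows "ring_idempotent R (e \<oplus> f)"
proof -
  have [simp]: "e \<in> carrier R" "f \<in> carrier R" "e \<otimes> e = e" "f \<otimes> f = f" "f \<otimes> e = \<zero>"
    using assms m_comm unfolding ring_idempotent_def by auto
  show ?thesis
    using assms(3) unfolding ring_idempotent_def by (simp add: l_distr r_distr)
qed

lemma idempotent_diff:
  assumes "ring_idempotent R e" "ring_idempotent R p" "e \<otimes> p = p"
  shows "ring_idempotent R (e \<ominus> p)" "(e \<ominus> p) \<otimes> p = \<zero>"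
proof -
  have [simp]: "e \<in> carrier R" "p \<in> carrier R" "e \<otimes> e = e" "p \<otimes> p = p"
    using assms unfolding ring_idempotent_def by auto
  have "(e \<ominus> p) \<otimes> (e \<ominus> p) = e \<otimes> e \<ominus> e \<otimes> p \<ominus> e \<otimes> p \<oplus> p \<otimes> p"
    using \<open>e \<in> carrier R\<close> \<open>p \<in> carrier R\<close> by algebra
  also have "\<dots> = e \<ominus> p"
    unfolding assms(3) \<open>e \<otimes> e = e\<close> \<open>p \<otimes> p = p\<close>
    using \<open>e \<in> carrier R\<close> \<open>p \<in> carrier R\<close> by algebra
  finally show "ring_idempotent R (e \<ominus> p)"
    unfolding ring_idempotent_def by simp
  have "(e \<ominus> p) \<otimes> p = e \<otimes> p \<ominus> p \<otimes> p"
    using \<open>e \<in> carrier R\<close> \<open>p \<in> carrier R\<close> by algebra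
  then show "(e \<ominus> p) \<otimes> p = \<zero>"
    by (simp add: assms(3))
qed

text \<open>
  The idempotent of a union: \<open>e + f - ef\<close> lies above the intersection \<open>ef\<close>, and the two have the
  same sum as \<open>e\<close> and \<open>f\<close>. It is idempotent because it splits into the orthogonal parts
  \<open>e - ef\<close> and \<open>f\<close>.
\<close>

lemma idempotent_join:
  assumes "ring_idempotent R e" "ring_idempotent R f"
  shows "ring_idempotent R (e \<oplus> f \<ominus> e \<otimes> f)" "(e \<oplus> f \<ominus> e \<otimes> f) \<otimes> (e \<otimes> f) = e \<otimes> f"
    "e \<oplus> f = (e \<oplus> f \<ominus> e \<otimes> f) \<oplus> e \<otimes> f"
proof -
  have carr: "e \<in> carrier R" "f \<in> carrier R" and idem: "e \<otimes> e = e" "f \<otimes> f = f"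
    using assms unfolding ring_idempotent_def by auto
  have ef: "ring_idempotent R (e \<otimes> f)" "e \<otimes> (e \<otimes> f) = e \<otimes> f"
    using assms carr idem by (auto intro: idempotent_mult simp flip: m_assoc)
  have "(e \<ominus> e \<otimes> f) \<otimes> f = e \<otimes> f \<ominus> e \<otimes> (f \<otimes> f)"
    using carr by algebra
  then have orth: "(e \<ominus> e \<otimes> f) \<otimes> f = \<zero>"
    using carr by (simp add: idem)
  have "e \<oplus> f \<ominus> e \<otimes> f = (e \<ominus> e \<otimes> f) \<oplus> f"
    using carr by algebra
  then show "ring_idempotent R (e \<oplus> f \<ominus> e \<otimes> f)"
    using idempotent_add_orthogonal[OF idempotent_diff(1)[OF assms(1) ef] assms(2) orth] by simp
  have "(e \<oplus> f \<ominus> e \<otimes> f) \<otimes> (e \<otimes> f)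
      = (e \<otimes> e) \<otimes> f \<oplus> e \<otimes> (f \<otimes> f) \<ominus> (e \<otimes> e) \<otimes> (f \<otimes> f)"
    using carr by algebra
  then show "(e \<oplus> f \<ominus> e \<otimes> f) \<otimes> (e \<otimes> f) = e \<otimes> f"
    using carr by (simp add: idem) algebra
  show "e \<oplus> f = (e \<oplus> f \<ominus> e \<otimes> f) \<oplus> e \<otimes> f"
    using carr by algebra
qed

section \<open>Nilpotency of six\<close>

text \<open>
  Let \<open>t = 1 + e + f + g\<close> be nilpotent. Multiplying by an idempotent turns it into \<open>1\<close> inside \<open>t\<close>,
  so \<open>efg t = 4 efg\<close> is nilpotent; from \<open>4 ef t = 12 ef + 4 efg\<close> then \<open>12 ef\<close>, and likewise
  \<open>12 eg\<close>, is nilpotent; and \<open>12 e t = 24 e + 12 ef + 12 eg\<close> settles \<open>24 e\<close>. The integers are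
  kept as named elements, with their products unevaluated, so that normalising does not expand
  them into long sums of ones.
\<close>

lemma nilpotent_24_idempotent:
  assumes e: "ring_idempotent R e" and f: "ring_idempotent R f" and g: "ring_idempotent R g"
    and t: "ring_nilpotent R (\<one> \<oplus> e \<oplus> f \<oplus> g)"
  defines "four \<equiv> \<one> \<oplus> \<one> \<oplus> \<one> \<oplus> \<one>" and "three \<equiv> \<one> \<oplus> \<one> \<oplus> \<one>"
  shows "ring_nilpotent R ((\<one> \<oplus> \<one>) \<otimes> (four \<otimes> three) \<otimes> e)"
proof -
  define twelve where "twelve = four \<otimes> three"
  have carr: "e \<in> carrier R" "f \<in> carrier R" "g \<in> carrier R"
      "four \<in> carrier R" "three \<in> carrier R" "twelve \<in> carrier R"
    and idem: "e \<otimes> e = e" "f \<otimes> f = f" "g \<otimes> g = g"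
    using e f g unfolding ring_idempotent_def four_def three_def twelve_def by auto
  define t' where "t' = \<one> \<oplus> e \<oplus> f \<oplus> g"
  have t': "t' \<in> carrier R" "ring_nilpotent R t'"
    using t carr unfolding t'_def by auto
  have "t' \<otimes> (e \<otimes> f \<otimes> g)
      = e \<otimes> f \<otimes> g \<oplus> (e \<otimes> e) \<otimes> f \<otimes> g \<oplus> e \<otimes> (f \<otimes> f) \<otimes> g \<oplus> e \<otimes> f \<otimes> (g \<otimes> g)"
    using carr unfolding t'_def by algebra
  also have "\<dots> = four \<otimes> (e \<otimes> f \<otimes> g)"
    unfolding idem four_def using carr by algebra
  finally have efg: "ring_nilpotent R (four \<otimes> (e \<otimes> f \<otimes> g))"
    using nilpotent_mult[OF t'(2)] carr by (metis m_closed)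
  \<comment> \<open>stated for \<open>x\<close>, \<open>y\<close> so that it serves for both \<open>f\<close>, \<open>g\<close> and \<open>g\<close>, \<open>f\<close>\<close>
  have step: "ring_nilpotent R (twelve \<otimes> (e \<otimes> x))"
    if x: "x \<in> carrier R" "x \<otimes> x = x" and y: "y \<in> carrier R"
      and eq: "t' = \<one> \<oplus> e \<oplus> x \<oplus> y" and p: "e \<otimes> x \<otimes> y = e \<otimes> f \<otimes> g" for x y
  proof -
    have "t' \<otimes> (e \<otimes> x \<otimes> four)
        = (e \<otimes> x \<oplus> (e \<otimes> e) \<otimes> x \<oplus> e \<otimes> (x \<otimes> x)) \<otimes> four \<oplus> four \<otimes> (e \<otimes> x \<otimes> y)"
      using carr x(1) y unfolding eq by algebra
    also have "e \<otimes> x \<oplus> (e \<otimes> e) \<otimes> x \<oplus> e \<otimes> (x \<otimes> x) = three \<otimes> (e \<otimes> x)"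
      unfolding idem x(2) three_def using carr x(1) by algebra
    also have "three \<otimes> (e \<otimes> x) \<otimes> four = twelve \<otimes> (e \<otimes> x)"
      unfolding twelve_def using carr x(1) by (simp add: m_ac)
    finally have "ring_nilpotent R (twelve \<otimes> (e \<otimes> x) \<oplus> four \<otimes> (e \<otimes> f \<otimes> g))"
      unfolding p using nilpotent_mult[OF t'(2)] carr x(1) by (metis m_closed)
    then show ?thesis
      using nilpotent_cancel efg carr x(1) by simp
  qed
  have ef: "ring_nilpotent R (twelve \<otimes> (e \<otimes> f))"
    using step[of f g] carr idem t'_def by simp
  have "t' = \<one> \<oplus> e \<oplus> g \<oplus> f" "e \<otimes> g \<otimes> f = e \<otimes> f \<otimes> g"
    unfolding t'_def using carr by algebra+
  then have eg: "ring_nilpotent R (twelve \<otimes> (e \<otimes> g))"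
    using step[of g f] carr idem by simp
  have "t' \<otimes> (e \<otimes> twelve) = twelve \<otimes> (e \<oplus> e \<otimes> e \<oplus> e \<otimes> f \<oplus> e \<otimes> g)"
    using carr unfolding t'_def by algebra
  also have "\<dots> = (\<one> \<oplus> \<one>) \<otimes> twelve \<otimes> e \<oplus> (twelve \<otimes> (e \<otimes> f) \<oplus> twelve \<otimes> (e \<otimes> g))"
    unfolding idem using carr by algebra
  finally have "ring_nilpotent R \<dots>"
    using nilpotent_mult[OF t'(2)] carr by (metis m_closed)
  then show ?thesis
    using nilpotent_cancel nilpotent_add[OF ef eg] carr unfolding twelve_def by simp
qed

text \<open>
  With \<open>t = 1 + e + f + g = -w\<close>, all of \<open>24 e\<close>, \<open>24 f\<close>, \<open>24 g\<close> and \<open>24 t\<close> are nilpotent, hence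
  so is \<open>24\<close>, which divides \<open>6^3\<close>.
\<close>

lemma nilpotent_six:
  assumes e: "ring_idempotent R e" and f: "ring_idempotent R f" and g: "ring_idempotent R g"
    and w: "ring_nilpotent R w" and sum: "e \<oplus> f \<oplus> g \<oplus> w = \<ominus> \<one>"
  shows "ring_nilpotent R ((\<one> \<oplus> \<one>) \<otimes> (\<one> \<oplus> \<one> \<oplus> \<one>))"
proof -
  have carr: "e \<in> carrier R" "f \<in> carrier R" "g \<in> carrier R" "w \<in> carrier R"
    using e f g w unfolding ring_idempotent_def ring_nilpotent_def by auto
  define t where "t = \<one> \<oplus> e \<oplus> f \<oplus> g"
  have perm: "t = \<one> \<oplus> e \<oplus> f \<oplus> g" "t = \<one> \<oplus> f \<oplus> g \<oplus> e" "t = \<one> \<oplus> g \<oplus> e \<oplus> f"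
    using carr unfolding t_def by algebra+
  have tc: "t \<in> carrier R"
    using carr unfolding t_def by simp
  have "t \<oplus> w = \<one> \<oplus> (e \<oplus> f \<oplus> g \<oplus> w)"
    using carr unfolding t_def by algebra
  then have "t \<oplus> w = \<zero>"
    unfolding sum by (simp add: r_neg)
  moreover have "ring_nilpotent R \<zero>"
    by (rule ring_nilpotentI[of _ 1]) auto
  ultimately have t: "ring_nilpotent R t"
    using nilpotent_cancel[OF tc _ w] by simp
  define k where "k = (\<one> \<oplus> \<one>) \<otimes> ((\<one> \<oplus> \<one> \<oplus> \<one> \<oplus> \<one>) \<otimes> (\<one> \<oplus> \<one> \<oplus> \<one>))"
  have kc: "k \<in> carrier R"
    unfolding k_def by simp
  have "ring_nilpotent R (k \<otimes> e)" "ring_nilpotent R (k \<otimes> f)" "ring_nilpotent R (k \<otimes> g)"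
    unfolding k_def using nilpotent_24_idempotent e f g t perm by metis+
  then have "ring_nilpotent R (k \<otimes> e \<oplus> k \<otimes> f \<oplus> k \<otimes> g)"
    using nilpotent_add by blast
  moreover have "t \<otimes> k = k \<oplus> (k \<otimes> e \<oplus> k \<otimes> f \<oplus> k \<otimes> g)"
    unfolding t_def using carr kc by algebra
  ultimately have k: "ring_nilpotent R k"
    using nilpotent_cancel[OF kc] nilpotent_mult[OF t kc] by simp
  define a where "a = \<one> \<oplus> \<one>"
  define b where "b = \<one> \<oplus> \<one> \<oplus> \<one>"
  have ab: "a \<in> carrier R" "b \<in> carrier R"
    unfolding a_def b_def by auto
  have "\<one> \<oplus> \<one> \<oplus> \<one> \<oplus> \<one> = a \<otimes> a"
    unfolding a_def by algebra
  then have "k = a \<otimes> (a \<otimes> a \<otimes> b)"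
    unfolding k_def a_def b_def by simp
  then have "(a \<otimes> b) [^] (3::nat) = k \<otimes> (b \<otimes> b)"
    using ab by (simp add: numeral_3_eq_3 m_ac)
  then have "ring_nilpotent R (a \<otimes> b)"
    using nilpotent_of_power[of "a \<otimes> b" 3] nilpotent_mult[OF k] ab by simp
  then show ?thesis
    unfolding a_def b_def .
qed

section \<open>From three idempotents to two\<close>

text \<open>
  The value \<open>3\<close> of \<open>e + f + g\<close> occurs on \<open>p = efg\<close>. There \<open>3\<close> itself is idempotent modulo
  nilpotents (it is \<open>1\<close> where \<open>2\<close> is nilpotent and \<open>0\<close> where \<open>3\<close> is), so one idempotent
  suffices on \<open>p\<close>, while away from \<open>p\<close> two suffice.
\<close>

lemma three_idempotents_to_two:
  assumes six: "ring_nilpotent R ((\<one> \<oplus> \<one>) \<otimes> (\<one> \<oplus> \<one> \<oplus> \<one>))"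
    and e: "ring_idempotent R e" and f: "ring_idempotent R f" and g: "ring_idempotent R g"
    and w: "ring_nilpotent R w"
  shows "\<exists>e' f' w'. ring_idempotent R e' \<and> ring_idempotent R f' \<and> ring_nilpotent R w' \<and>
    e \<oplus> f \<oplus> g \<oplus> w = e' \<oplus> f' \<oplus> w'"
proof -
  have carr: "e \<in> carrier R" "f \<in> carrier R" "g \<in> carrier R" "w \<in> carrier R"
    using e f g w unfolding ring_idempotent_def ring_nilpotent_def by auto
  define three where "three = \<one> \<oplus> \<one> \<oplus> \<one>"
  define two where "two = \<one> \<oplus> \<one>"
  have numerals: "two \<in> carrier R" "three \<in> carrier R" "three = \<one> \<oplus> two"
    unfolding two_def three_def by (simp_all add: a_assoc)
  \<comment> \<open>the complement of \<open>3\<close> is \<open>-2\<close>, and their product \<open>-6\<close> is nilpotent, so \<open>3\<close> lifts\<close>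
  have "three \<oplus> \<ominus> two = \<one>"
    unfolding numerals(3) using numerals(1) by (simp add: a_assoc r_neg)
  moreover have "three \<otimes> \<ominus> two = (two \<otimes> three) \<otimes> \<ominus> \<one>"
    using numerals(1,2) by (simp add: r_minus m_comm)
  moreover have "ring_nilpotent R ((two \<otimes> three) \<otimes> \<ominus> \<one>)"
    using six unfolding two_def three_def by (rule nilpotent_mult) simp
  ultimately obtain h n
    where h: "ring_idempotent R h" and n: "ring_nilpotent R n" and hn: "three = h \<oplus> n"
    using lift_idempotent[of three "\<ominus> two"] numerals by auto
  define u where "u = e \<oplus> f \<ominus> e \<otimes> f"
  define v where "v = e \<otimes> f \<oplus> g \<ominus> e \<otimes> f \<otimes> g"
  define p where "p = e \<otimes> f \<otimes> g"
  define q where "q = p \<otimes> h"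
  have ef: "ring_idempotent R (e \<otimes> f)"
    using e f by (rule idempotent_mult)
  have u: "ring_idempotent R u" "u \<otimes> (e \<otimes> f) = e \<otimes> f" "e \<oplus> f = u \<oplus> e \<otimes> f"
    using idempotent_join[OF e f] unfolding u_def by auto
  have v: "ring_idempotent R v" "v \<otimes> p = p" "e \<otimes> f \<oplus> g = v \<oplus> p"
    using idempotent_join[OF ef g] unfolding v_def p_def by auto
  have p: "ring_idempotent R p"
    unfolding p_def using ef g by (rule idempotent_mult)
  have q: "ring_idempotent R q"
    unfolding q_def using p h by (rule idempotent_mult)
  have carr': "u \<in> carrier R" "v \<in> carrier R" "p \<in> carrier R" "q \<in> carrier R"
      "h \<in> carrier R" "n \<in> carrier R"
    using u(1) v(1) p q h n unfolding ring_idempotent_def ring_nilpotent_def by auto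
  have "u \<otimes> p = u \<otimes> (e \<otimes> f) \<otimes> g"
    unfolding p_def using carr carr' by algebra
  then have up: "u \<otimes> p = p"
    unfolding u(2) p_def .
  note diff_u = idempotent_diff[OF u(1) p up] and diff_v = idempotent_diff[OF v(1) p v(2)]
  have "(u \<ominus> p) \<otimes> q = (u \<ominus> p) \<otimes> p \<otimes> h"
    unfolding q_def using carr' by algebra
  then have "(u \<ominus> p) \<otimes> q = \<zero>"
    unfolding diff_u(2) using carr' by simp
  then have e': "ring_idempotent R ((u \<ominus> p) \<oplus> q)"
    using idempotent_add_orthogonal diff_u(1) q by blast
  have w': "ring_nilpotent R (n \<otimes> p \<oplus> w)"
    using nilpotent_add nilpotent_mult n w carr' by blast
  have ppp: "p \<oplus> p \<oplus> p = p \<otimes> three"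
    unfolding three_def using carr' by algebra
  have "e \<oplus> f \<oplus> g \<oplus> w = u \<oplus> (e \<otimes> f \<oplus> g) \<oplus> w"
    unfolding u(3) using carr carr' by algebra
  also have "\<dots> = (u \<ominus> p) \<oplus> (v \<ominus> p) \<oplus> (p \<oplus> p \<oplus> p) \<oplus> w"
    unfolding v(3) using carr carr' by algebra
  also have "\<dots> = (u \<ominus> p) \<oplus> (v \<ominus> p) \<oplus> p \<otimes> three \<oplus> w"
    unfolding ppp ..
  also have "\<dots> = ((u \<ominus> p) \<oplus> q) \<oplus> (v \<ominus> p) \<oplus> (n \<otimes> p \<oplus> w)"
    unfolding hn q_def using carr carr' by algebra
  finally show ?thesis
    using e' diff_v(1) w' by blast
qed

end

section \<open>Commutative subrings around commuting elements\<close>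

definition commutant :: "('a, 'm) ring_scheme \<Rightarrow> 'a set \<Rightarrow> 'a set" where
  "commutant R X = {y \<in> carrier R. \<forall>x\<in>X. x \<otimes>\<^bsub>R\<^esub> y = y \<otimes>\<^bsub>R\<^esub> x}"

context ring
begin

lemma pairwise_commute_insert_zero:
  assumes "X \<subseteq> carrier R" "pairwise_commute R X"
  shows "pairwise_commute R (insert \<zero> X)"
  unfolding pairwise_commute_def
proof (intro ballI)
  fix x y assume "x \<in> insert \<zero> X" "y \<in> insert \<zero> X"
  moreover from this have "x \<in> carrier R" "y \<in> carrier R"
    using assms(1) by auto
  ultimately show "x \<otimes> y = y \<otimes> x"
    using assms(2) unfolding pairwise_commute_def by (cases "x = \<zero> \<or> y = \<zero>") auto
qed

lemma subring_commutant:
  assumes "X \<subseteq> carrier R"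
  shows "subring (commutant R X) R"
proof (rule subringI)
  fix y z assume y: "y \<in> commutant R X" and z: "z \<in> commutant R X"
  have "x \<otimes> (y \<otimes> z) = (y \<otimes> z) \<otimes> x" if "x \<in> X" for x
  proof -
    have "x \<in> carrier R" "y \<in> carrier R" "z \<in> carrier R" "x \<otimes> y = y \<otimes> x" "x \<otimes> z = z \<otimes> x"
      using that y z assms unfolding commutant_def by auto
    then show ?thesis
      by (metis m_assoc)
  qed
  then show "y \<otimes> z \<in> commutant R X"
    using y z unfolding commutant_def by auto
  show "y \<oplus> z \<in> commutant R X"
    using y z assms unfolding commutant_def by (auto simp: l_distr r_distr subset_iff)
next
  fix y assume "y \<in> commutant R X"
  then show "\<ominus> y \<in> commutant R X"
    using assms unfolding commutant_def by (auto simp: l_minus r_minus subset_iff)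
qed (use assms in \<open>auto simp: commutant_def subset_iff\<close>)

text \<open>
  If \<open>X\<close> commutes with itself, it lies in its commutant \<open>C\<close>. Therefore the commutant of \<open>C\<close> is
  contained in \<open>C\<close>, and so its elements commute with each other.
\<close>

lemma cring_double_commutant:
  assumes "X \<subseteq> carrier R" "pairwise_commute R X"
  shows "cring (R\<lparr>carrier := commutant R (commutant R X)\<rparr>)" "X \<subseteq> commutant R (commutant R X)"
proof -
  let ?C = "commutant R X"
  let ?D = "commutant R ?C"
  have C: "?C \<subseteq> carrier R"
    unfolding commutant_def by auto
  have "X \<subseteq> ?C"
    using assms unfolding commutant_def pairwise_commute_def by auto
  then have "?D \<subseteq> ?C"
    unfolding commutant_def by auto
  have "subcring ?D R"
  proof (rule subcringI)
    show "subring ?D R"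
      using C by (rule subring_commutant)
  next
    fix y z assume "y \<in> ?D" "z \<in> ?D"
    then have "y \<in> ?C" "z \<in> ?D"
      using \<open>?D \<subseteq> ?C\<close> by blast+
    then show "y \<otimes> z = z \<otimes> y"
      unfolding commutant_def[of R ?C] by blast
  qed
  then show "cring (R\<lparr>carrier := ?D\<rparr>)"
    using iffD1[OF subcring_iff[OF subcringE(1)]] by blast
  show "X \<subseteq> ?D"
    using assms(1) unfolding commutant_def by auto
qed

end

lemma ring_idempotent_subring_iff:
  assumes "H \<subseteq> carrier R"
  shows "ring_idempotent (R\<lparr>carrier := H\<rparr>) x \<longleftrightarrow> x \<in> H \<and> ring_idempotent R x"
  using assms unfolding ring_idempotent_def by auto

lemma ring_nilpotent_subring_iff:
  assumes "H \<subseteq> carrier R"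
  shows "ring_nilpotent (R\<lparr>carrier := H\<rparr>) x \<longleftrightarrow> x \<in> H \<and> ring_nilpotent R x"
  using assms unfolding ring_nilpotent_def nat_pow_def by auto

section \<open>Strongly 2-nil-clean rings\<close>

theorem theorem2p7:
  fixes R :: "('a, 'm) ring_scheme" (structure)
  assumes "ring R"
  shows
    "(strongly_2_nil_clean R \<longleftrightarrow>
       (\<forall>a\<in>carrier R. \<exists>e f w.
          ring_idempotent R e \<and> ring_idempotent R f \<and> ring_nilpotent R w \<and>
          pairwise_commute R {e, f, w} \<and> a = e \<oplus> f \<oplus> w))
     \<and>
     (strongly_2_nil_clean R \<longleftrightarrow>
       (\<forall>a\<in>carrier R. \<exists>e f g w.
          ring_idempotent R e \<and> ring_idempotent R f \<and> ring_idempotent R g \<and>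
          ring_nilpotent R w \<and>
          pairwise_commute R {e, f, g, w} \<and> a = e \<oplus> f \<oplus> g \<oplus> w))"
    (is "?two_def \<and> (?clean \<longleftrightarrow> (\<forall>a\<in>carrier R. ?three a))")
proof
  interpret ring R by fact
  show ?two_def
    by (rule strongly_2_nil_clean_def)
  show "?clean \<longleftrightarrow> (\<forall>a\<in>carrier R. ?three a)"
  proof
    assume clean: ?clean
    show "\<forall>a\<in>carrier R. ?three a"
    proof
      fix a assume "a \<in> carrier R"
      then obtain e f w where *: "ring_idempotent R e" "ring_idempotent R f" "ring_nilpotent R w"
        "pairwise_commute R {e, f, w}" "a = e \<oplus> f \<oplus> w"
        using clean unfolding strongly_2_nil_clean_def by meson
      have carr: "e \<in> carrier R" "f \<in> carrier R" "w \<in> carrier R"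
        using * unfolding ring_idempotent_def ring_nilpotent_def by auto
      have "pairwise_commute R {e, f, \<zero>, w}"
        using pairwise_commute_insert_zero[OF _ *(4)] carr by (simp add: insert_commute)
      moreover have "ring_idempotent R \<zero>"
        unfolding ring_idempotent_def by simp
      ultimately show "?three a"
        using * carr by (intro exI[of _ e] exI[of _ f] exI[of _ \<zero>] exI[of _ w]) simp
    qed
  next
    assume three: "\<forall>a\<in>carrier R. ?three a"
    \<comment> \<open>each decomposition takes place in a commutative subring, which depends on the element\<close>
    have sub: "\<exists>H e f g w. H \<subseteq> carrier R \<and> cring (R\<lparr>carrier := H\<rparr>) \<and>
        ring_idempotent (R\<lparr>carrier := H\<rparr>) e \<and> ring_idempotent (R\<lparr>carrier := H\<rparr>) f \<and>
        ring_idempotent (R\<lparr>carrier := H\<rparr>) g \<and> ring_nilpotent (R\<lparr>carrier := H\<rparr>) w \<and>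
        a = e \<oplus> f \<oplus> g \<oplus> w" if a: "a \<in> carrier R" for a
    proof -
      obtain e f g w where *: "ring_idempotent R e" "ring_idempotent R f" "ring_idempotent R g"
        "ring_nilpotent R w" "pairwise_commute R {e, f, g, w}" "a = e \<oplus> f \<oplus> g \<oplus> w"
        using three a by meson
      have X: "{e, f, g, w} \<subseteq> carrier R"
        using * unfolding ring_idempotent_def ring_nilpotent_def by auto
      define H where "H = commutant R (commutant R {e, f, g, w})"
      have H: "cring (R\<lparr>carrier := H\<rparr>)" "{e, f, g, w} \<subseteq> H"
        unfolding H_def using cring_double_commutant[OF X *(5)] by auto
      moreover have "H \<subseteq> carrier R"
        unfolding H_def commutant_def by auto
      ultimately show ?thesis
        using * by (intro exI[of _ H] exI[of _ e] exI[of _ f] exI[of _ g] exI[of _ w])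
          (simp add: ring_idempotent_subring_iff ring_nilpotent_subring_iff)
    qed
    have six: "ring_nilpotent R ((\<one> \<oplus> \<one>) \<otimes> (\<one> \<oplus> \<one> \<oplus> \<one>))"
    proof -
      obtain H e f g w where H: "H \<subseteq> carrier R" "cring (R\<lparr>carrier := H\<rparr>)"
        and dec: "ring_idempotent (R\<lparr>carrier := H\<rparr>) e" "ring_idempotent (R\<lparr>carrier := H\<rparr>) f"
          "ring_idempotent (R\<lparr>carrier := H\<rparr>) g" "ring_nilpotent (R\<lparr>carrier := H\<rparr>) w"
        and sum: "\<ominus> \<one> = e \<oplus> f \<oplus> g \<oplus> w"
        using sub[of "\<ominus> \<one>"] by auto
      interpret S: cring "R\<lparr>carrier := H\<rparr>" by fact
      have carr: "e \<in> H" "f \<in> H" "g \<in> H" "w \<in> H"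
        using dec unfolding ring_idempotent_def ring_nilpotent_def by auto
      \<comment> \<open>additive inverses in the subring are a priori different, hence the detour over a sum\<close>
      have "e \<oplus> f \<oplus> g \<oplus> w \<oplus> \<one> = \<zero>"
        unfolding sum[symmetric] by (simp add: l_neg)
      then have "\<ominus>\<^bsub>R\<lparr>carrier := H\<rparr>\<^esub> \<one> = e \<oplus> f \<oplus> g \<oplus> w"
        using S.minus_equality[of "e \<oplus> f \<oplus> g \<oplus> w" \<one>] S.add.m_closed S.one_closed carr by simp
      then have "ring_nilpotent (R\<lparr>carrier := H\<rparr>) ((\<one> \<oplus> \<one>) \<otimes> (\<one> \<oplus> \<one> \<oplus> \<one>))"
        using S.nilpotent_six[OF dec] by simp
      then show ?thesis
        using ring_nilpotent_subring_iff[OF H(1)] by blast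
    qed
    show ?clean
      unfolding strongly_2_nil_clean_def
    proof
      fix a assume "a \<in> carrier R"
      then obtain H e f g w where H: "H \<subseteq> carrier R" "cring (R\<lparr>carrier := H\<rparr>)"
        and dec: "ring_idempotent (R\<lparr>carrier := H\<rparr>) e" "ring_idempotent (R\<lparr>carrier := H\<rparr>) f"
          "ring_idempotent (R\<lparr>carrier := H\<rparr>) g" "ring_nilpotent (R\<lparr>carrier := H\<rparr>) w"
        and a: "a = e \<oplus> f \<oplus> g \<oplus> w"
        using sub by blast
      interpret S: cring "R\<lparr>carrier := H\<rparr>" by fact
      have "(\<one> \<oplus> \<one>) \<otimes> (\<one> \<oplus> \<one> \<oplus> \<one>) \<in> H"
        using S.m_closed S.add.m_closed S.one_closed by simp
      then have "ring_nilpotent (R\<lparr>carrier := H\<rparr>) ((\<one> \<oplus> \<one>) \<otimes> (\<one> \<oplus> \<one> \<oplus> \<one>))"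
        using six ring_nilpotent_subring_iff[OF H(1)] by blast
      then obtain e' f' w' where dec': "ring_idempotent (R\<lparr>carrier := H\<rparr>) e'"
          "ring_idempotent (R\<lparr>carrier := H\<rparr>) f'" "ring_nilpotent (R\<lparr>carrier := H\<rparr>) w'"
        and a': "a = e' \<oplus> f' \<oplus> w'"
        using S.three_idempotents_to_two[OF _ dec] a by auto
      have "e' \<in> H" "f' \<in> H" "w' \<in> H"
        using dec' unfolding ring_idempotent_def ring_nilpotent_def by auto
      then have "pairwise_commute R {e', f', w'}"
        using S.m_comm unfolding pairwise_commute_def by auto
      then show "\<exists>e f w. ring_idempotent R e \<and> ring_idempotent R f \<and> ring_nilpotent R w \<and>
          pairwise_commute R {e, f, w} \<and> a = e \<oplus> f \<oplus> w"
        using dec' a' ring_idempotent_subring_iff[OF H(1)] ring_nilpotent_subring_iff[OF H(1)]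
        by blast
    qed
  qed
qed

end
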